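(* For every integer $m\ge 0$ define $$c_m := \frac{1}{\sqrt{2\pi}}\int_{-\infty}^{\infty}[y^m]\exp\left(-\frac{t^2}{2}+\sum_{j\ge 3}\frac{(it)^j}{j!}\,y^{j-2}\right)\mathrm{d}t$$ and $$d_m := \frac{1}{\sqrt{2\pi}}\int_{-\infty}^{\infty}[y^m]\exp\left(-\frac{t^2}{2}+\sum_{j\ge 3}\frac{(it)^j}{j}\,y^{j-2}\right)\mathrm{d}t .$$ Then $c_m=d_m$ for all $m=0,1,2,\dots$.
   Context: Here $i=\sqrt{-1}$ and $[y^m]F(y)$ denotes the coefficient of $y^m$ in the Taylor (formal power series) expansion of $F$ in $y$. For fixed real $t$, the exponentials are regarded as formal power series in $y$: the exponential equals $e^{-t^2/2}$ times the formal exponential of a power series in $y$ with zero constant term. Coefficient extraction is performed inside the integral, before integrating over $t$; for each $m$ the integrand is $e^{-t^2/2}$ times a polynomial in $t$ (with complex coefficients), so the integrals converge absolutely. *)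

theory Defs
  imports "HOL-Analysis.Analysis" "HOL-Computational_Algebra.Computational_Algebra"
begin

text \<open>
  Formal exponential of a power series with arbitrary constant term: the constant term
  \<open>fps_nth F 0\<close> is exponentiated as a complex number, and the remaining series, which has zero
  constant term, is substituted into the formal exponential series.
\<close>

definition formal_exp :: "complex fps \<Rightarrow> complex fps" where
  "formal_exp F = fps_const (exp (fps_nth F 0)) * (fps_exp 1 oo (F - fps_const (fps_nth F 0)))"

text \<open>
  The exponents, as power series in \<open>y\<close> for fixed real \<open>t\<close>.  The summand with index
  \<open>j \<ge> 3\<close> belongs to \<open>y ^ (j - 2)\<close>, so the coefficient of \<open>y ^ n\<close> for \<open>n \<ge> 1\<close> is the
  one with \<open>j = n + 2\<close>.
\<close>

definition exponent_c :: "real \<Rightarrow> complex fps" where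
  "exponent_c t = fps_const (- (complex_of_real t ^ 2 / 2)) +
     Abs_fps (\<lambda>n. if n = 0 then 0 else (\<i> * complex_of_real t) ^ (n + 2) / fact (n + 2))"

definition exponent_d :: "real \<Rightarrow> complex fps" where
  "exponent_d t = fps_const (- (complex_of_real t ^ 2 / 2)) +
     Abs_fps (\<lambda>n. if n = 0 then 0 else (\<i> * complex_of_real t) ^ (n + 2) / of_nat (n + 2))"

definition c_coeff :: "nat \<Rightarrow> complex" where
  "c_coeff m = complex_of_real (1 / sqrt (2 * pi)) * (LINT t|lborel. fps_nth (formal_exp (exponent_c t)) m)"

definition d_coeff :: "nat \<Rightarrow> complex" where
  "d_coeff m = complex_of_real (1 / sqrt (2 * pi)) * (LINT t|lborel. fps_nth (formal_exp (exponent_d t)) m)"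

end

(* Integrating the coefficients against the Gaussian expresses the m-th coefficient attached to a
   phase f(z) = z^2/2 + ... as 0 for odd m, and for m = 2n as (-1)^n (2n-1)!! times the
   z^(2n)-coefficient of (2 f(z)/z^2)^(-n-1/2). By Lagrange inversion the latter is the
   w^(2n)-coefficient of zeta'(w), where zeta is the inverse series of w = sqrt (2 f(z)).
   The two phases are f(z) = e^z - 1 - z and g(z) = - ln (1 - z) - z, and g(1 - e^z) = f(z).
   Hence zeta_g(-w) = 1 - exp (zeta_f(w)); differentiating this and f(zeta_f(w)) = w^2/2 gives
   zeta_g'(-w) = zeta_f'(w) + w, so the even coefficients of zeta_f' and zeta_g' agree. *)

theory Submission
  imports Defs "HOL-Probability.Distributions"
begin

section \<open>Lagrange inversion by formal residues\<close>

text \<open>With \<open>w = X R\<close> and \<open>Q = 1/R\<close> the coefficient is the residue of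
  \<open>w' / w^(j+1)\<close>. For \<open>j > 0\<close> this is the derivative of
  \<open>- w^(-j) / j\<close>, which has no residue.\<close>

lemma fps_nth_deriv_mult_power_reciprocal:
  fixes R Q :: "'a::field_char_0 fps"
  assumes RQ: "R * Q = 1"
  shows "fps_nth (fps_deriv (fps_X * R) * Q ^ Suc j) j = (if j = 0 then 1 else 0)"
proof (cases j)
  case 0
  have "fps_nth R 0 * fps_nth Q 0 = 1"
    using arg_cong[OF RQ, of "\<lambda>F. fps_nth F 0"] by simp
  then show ?thesis using 0 by simp
next
  case (Suc i)
  have "R * fps_deriv Q + fps_deriv R * Q = 0"
    using arg_cong[OF RQ, of fps_deriv] by simp
  then have "Q * (R * fps_deriv Q) + fps_deriv R * Q * Q = 0"
    by (metis distrib_left mult.commute mult_zero_right)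
  then have "fps_deriv R * Q * Q = - fps_deriv Q"
    using RQ by (metis add_eq_0_iff mult.assoc mult.commute mult.left_neutral)
  moreover have "fps_deriv (fps_X * R) * Q ^ Suc j
      = R * Q * Q ^ Suc i + fps_X * (fps_deriv R * Q * Q * Q ^ i)"
    using Suc by (simp add: algebra_simps)
  ultimately have eq: "fps_deriv (fps_X * R) * Q ^ Suc j
      = Q ^ Suc i - fps_X * (fps_deriv Q * Q ^ i)"
    using RQ by simp
  \<comment> \<open>Since \<open>Q' Q^i = (Q^(i+1))' / (i+1)\<close> and \<open>X d/dX\<close>
    multiplies the coefficient of index \<open>i+1\<close> by \<open>i+1\<close>, the two terms of
    \<open>eq\<close> cancel at that index.\<close>
  have "of_nat (Suc i) * fps_nth (fps_deriv Q * Q ^ i) i = fps_nth (fps_deriv (Q ^ Suc i)) i"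
    unfolding fps_deriv_power by (simp add: mult.assoc del: power_Suc of_nat_Suc flip: fps_of_nat)
  also have "\<dots> = of_nat (Suc i) * fps_nth (Q ^ Suc i) (Suc i)"
    by (simp del: power_Suc of_nat_Suc)
  finally have "fps_nth (fps_deriv Q * Q ^ i) i = fps_nth (Q ^ Suc i) (Suc i)"
    by (simp del: power_Suc of_nat_Suc)
  then show ?thesis using Suc eq by (simp del: power_Suc)
qed

text \<open>Formally, with \<open>w = X R\<close>, this is
  \<open>Res B(w(z)) w'(z) / w(z)\<^sup>N\<^sup>+\<^sup>1 dz = Res B(w) / w\<^sup>N\<^sup>+\<^sup>1 dw\<close>.\<close>

lemma fps_nth_change_of_variable:
  fixes R Q B :: "'a::field_char_0 fps"
  assumes RQ: "R * Q = 1"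
  shows "fps_nth ((B oo (fps_X * R)) * fps_deriv (fps_X * R) * Q ^ Suc N) N = fps_nth B N"
proof -
  define w where "w = fps_X * R"
  define G where "G = fps_deriv w * Q ^ Suc N"
  \<comment> \<open>Cancelling \<open>R^k Q^k\<close> leaves \<open>X^k w' Q^(N-k+1)\<close>, so the
    shift by \<open>k\<close> reduces this to the residue with \<open>j = N - k\<close>.\<close>
  have term_eq: "fps_nth (w ^ k * G) N = (if k = N then 1 else 0)" if "k \<le> N" for k
  proof -
    have "R ^ k * Q ^ k = 1"
      using RQ by (metis power_mult_distrib power_one)
    moreover have "Q ^ Suc N = Q ^ k * Q ^ Suc (N - k)"
      using that by (simp flip: power_add add: Suc_diff_le[symmetric] del: power_Suc)
    moreover have "w ^ k * (fps_deriv w * (Q ^ k * Q ^ Suc (N - k)))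
        = fps_X ^ k * (R ^ k * Q ^ k) * (fps_deriv w * Q ^ Suc (N - k))"
      by (simp only: w_def power_mult_distrib mult_ac)
    ultimately have "w ^ k * G = fps_X ^ k * (fps_deriv w * Q ^ Suc (N - k))"
      by (simp only: G_def mult_1_right)
    then show ?thesis
      using that fps_nth_deriv_mult_power_reciprocal[OF RQ, of "N - k"]
      by (simp add: fps_X_power_mult_nth w_def del: power_Suc)
  qed
  \<comment> \<open>This allows every inner sum over \<open>k\<close> to run up to \<open>N\<close>,
    after which the two sums can be exchanged.\<close>
  have low: "fps_nth (w ^ k) i = 0" if "i < k" for i k
    using that by (simp add: w_def power_mult_distrib fps_X_power_mult_nth)
  have "fps_nth ((B oo w) * G) N
      = (\<Sum>i=0..N. (\<Sum>k=0..i. fps_nth B k * fps_nth (w ^ k) i) * fps_nth G (N - i))"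
    by (simp add: fps_mult_nth fps_compose_nth)
  also have "\<dots> = (\<Sum>i=0..N. (\<Sum>k=0..N. fps_nth B k * fps_nth (w ^ k) i) * fps_nth G (N - i))"
    by (intro sum.cong refl arg_cong2[where f = "(*)"] sum.mono_neutral_left) (auto simp: low)
  also have "\<dots> = (\<Sum>k=0..N. fps_nth B k * fps_nth (w ^ k * G) N)"
    unfolding fps_mult_nth sum_distrib_left sum_distrib_right mult.assoc by (rule sum.swap)
  also have "\<dots> = fps_nth B N"
    by (simp add: term_eq if_distrib[of "(*) _"] cong: if_cong)
  finally show ?thesis by (simp add: w_def G_def mult.assoc)
qed

text \<open>Take \<open>B\<close> to be the derivative of the inverse series of
  \<open>w = X R\<close>: the chain rule gives \<open>B(w) w' = 1\<close>, so only
  \<open>Q^(N+1)\<close> is left in the change of variable.\<close>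

lemma fps_lagrange_inversion_deriv:
  fixes R Q :: "'a::field_char_0 fps"
  assumes RQ: "R * Q = 1"
  shows "fps_nth (fps_deriv (fps_inv (fps_X * R))) N = fps_nth (Q ^ Suc N) N"
proof -
  let ?w = "fps_X * R"
  have "fps_nth R 0 * fps_nth Q 0 = 1"
    using arg_cong[OF RQ, of "\<lambda>F. fps_nth F 0"] by simp
  then have "fps_inv ?w oo ?w = fps_X"
    by (intro fps_inv) auto
  then have "(fps_deriv (fps_inv ?w) oo ?w) * fps_deriv ?w = 1"
    using fps_compose_deriv[of ?w "fps_inv ?w"] by simp
  then show ?thesis
    using fps_nth_change_of_variable[OF RQ, of "fps_deriv (fps_inv ?w)" N]
    by (simp del: power_Suc)
qed

section \<open>Square roots of phases\<close>

lemma fps_binomial_half_compose: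
  fixes p :: "'a::field_char_0 fps"
  assumes "fps_nth p 0 = 0"
  shows "(fps_binomial (1 / 2) oo p) * (fps_binomial (- (1 / 2)) oo p) = 1"
    and "(fps_binomial (1 / 2) oo p)\<^sup>2 = 1 + p"
    and "(fps_binomial (- (1 / 2)) oo p) ^ k = fps_binomial (- (of_nat k / 2)) oo p"
proof -
  have "fps_binomial (1 / 2) * fps_binomial (- (1 / 2)) = (1 :: 'a fps)"
    by (simp flip: fps_binomial_add_mult)
  then show "(fps_binomial (1 / 2) oo p) * (fps_binomial (- (1 / 2)) oo p) = 1"
    using assms by (simp flip: fps_compose_mult_distrib)
  have "fps_binomial (1 / 2) ^ 2 = (1 + fps_X :: 'a fps)"
    using fps_binomial_of_nat[of 1, where 'a = 'a] by (simp add: fps_binomial_power)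
  then show "(fps_binomial (1 / 2) oo p)\<^sup>2 = 1 + p"
    using assms by (simp add: fps_compose_power fps_compose_add_distrib)
  show "(fps_binomial (- (1 / 2)) oo p) ^ k = fps_binomial (- (of_nat k / 2)) oo p"
    using assms by (simp add: fps_compose_power fps_binomial_power)
qed

text \<open>For the phase \<open>f = X^2 (1/2 + p)\<close> this is the branch of
  \<open>sqrt (2 f)\<close> with linear coefficient 1.\<close>

definition phase_sqrt :: "'a::field_char_0 fps \<Rightarrow> 'a fps" where
  "phase_sqrt p = fps_X * (fps_binomial (1 / 2) oo (2 * p))"

lemma phase_sqrt_power2:
  assumes "fps_nth p 0 = 0"
  shows "(phase_sqrt p)\<^sup>2 = fps_X\<^sup>2 * (1 + 2 * p)"
  using fps_binomial_half_compose(2)[of "2 * p"] assms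
  by (simp add: phase_sqrt_def power_mult_distrib)

lemma phase_sqrt_nth [simp]:
  "fps_nth (phase_sqrt p) 0 = 0" "fps_nth (phase_sqrt p) (Suc 0) = 1"
  by (simp_all add: phase_sqrt_def)

lemma phase_sqrt_inv:
  "fps_inv (phase_sqrt p) oo phase_sqrt p = fps_X"
  "phase_sqrt p oo fps_inv (phase_sqrt p) = fps_X"
  by (simp_all add: fps_inv fps_inv_right)

text \<open>Lagrange inversion with \<open>R = (1 + 2p)^(1/2)\<close>, where
  \<open>Q^(N+1) = (1 + 2p)^(-(N+1)/2)\<close>.\<close>

lemma fps_nth_binomial_compose:
  fixes p :: "'a::field_char_0 fps"
  assumes "fps_nth p 0 = 0"
  shows "fps_nth (fps_binomial (- (of_nat (Suc N) / 2)) oo (2 * p)) N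
    = fps_nth (fps_deriv (fps_inv (phase_sqrt p))) N"
proof -
  have "fps_nth (2 * p) 0 = 0" using assms by simp
  note half = fps_binomial_half_compose[OF this]
  show ?thesis
    unfolding phase_sqrt_def fps_lagrange_inversion_deriv[OF half(1)] half(3) ..
qed

text \<open>\<open>X\<^sup>2 (1/2 + tail_fps a)\<close> is the phase \<open>\<Sum>j\<ge>2. a j X\<^sup>j\<close> when \<open>a 2 = 1/2\<close>.\<close>

definition tail_fps :: "(nat \<Rightarrow> 'a::zero) \<Rightarrow> 'a fps" where
  "tail_fps a = Abs_fps (\<lambda>n. if n = 0 then 0 else a (n + 2))"

lemma tail_fps_nth: "fps_nth (tail_fps a) n = (if n = 0 then 0 else a (n + 2))"
  by (simp add: tail_fps_def)

lemma phase_sqrt_tail_power2: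
  fixes a :: "nat \<Rightarrow> 'a::field_char_0"
  assumes "a 2 = 1 / 2"
  shows "(phase_sqrt (tail_fps a))\<^sup>2 = 2 * Abs_fps (\<lambda>n. if n < 2 then 0 else a n)"
proof (rule fps_ext)
  fix n :: nat
  have "n = 2" if "2 \<le> n" "n - 2 = 0" using that by simp
  moreover have "n - 2 + 2 = n" if "2 \<le> n" using that by simp
  moreover have "fps_nth ((phase_sqrt (tail_fps a))\<^sup>2) n
      = (if n < 2 then 0 else (if n - 2 = 0 then 1 else 0) + 2 * fps_nth (tail_fps a) (n - 2))"
    by (simp add: phase_sqrt_power2 tail_fps_nth[of a 0] fps_X_power_mult_nth numeral_fps_const)
  \<comment> \<open>At index 2 the left side has the constant 1 of \<open>1 + 2p\<close>, the right
    side \<open>2 * a 2\<close>.\<close>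
  moreover have "2 * a 2 = 1" unfolding assms by simp
  ultimately show "fps_nth ((phase_sqrt (tail_fps a))\<^sup>2) n
      = fps_nth (2 * Abs_fps (\<lambda>n. if n < 2 then 0 else a n)) n"
    by (auto simp: tail_fps_nth numeral_fps_const)
qed

section \<open>The two phases and the substitution between them\<close>

abbreviation phase_c :: "'a::field_char_0 fps" where
  "phase_c \<equiv> tail_fps (\<lambda>n. 1 / fact n)"

abbreviation phase_d :: "'a::field_char_0 fps" where
  "phase_d \<equiv> tail_fps (\<lambda>n. 1 / of_nat n)"

text \<open>The expansion of \<open>- ln (1 - z) - z\<close>.\<close>

definition log_phase :: "'a::field_char_0 fps" where
  "log_phase = Abs_fps (\<lambda>n. if n < 2 then 0 else 1 / of_nat n)"

lemma phase_sqrt_c_power2: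
  "(phase_sqrt phase_c)\<^sup>2 = 2 * (fps_exp 1 - 1 - fps_X :: 'a::field_char_0 fps)"
proof -
  have "Abs_fps (\<lambda>n. if n < 2 then 0 else 1 / fact n) = (fps_exp 1 - 1 - fps_X :: 'a fps)"
    by (rule fps_ext) (auto simp: less_2_cases_iff)
  then show ?thesis by (simp add: phase_sqrt_tail_power2)
qed

lemma phase_sqrt_d_power2: "(phase_sqrt phase_d)\<^sup>2 = 2 * (log_phase :: 'a::field_char_0 fps)"
  by (simp add: phase_sqrt_tail_power2 log_phase_def)

lemma log_phase_deriv: "(1 - fps_X) * fps_deriv log_phase = (fps_X :: 'a::field_char_0 fps)"
proof -
  have "fps_deriv log_phase = Abs_fps (\<lambda>n. if n = 0 then 0 else (1 :: 'a))"
    by (rule fps_ext) (simp add: log_phase_def del: of_nat_Suc)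
  then have "(1 - fps_X) * fps_deriv log_phase
      = (1 - fps_X) * Abs_fps (\<lambda>n. if n = 0 then 0 else (1 :: 'a))"
    by (simp only:)
  also have "\<dots> = fps_X"
    by (rule fps_ext) (simp add: left_diff_distrib)
  finally show ?thesis .
qed

text \<open>Both sides have constant term 0, and substituting \<open>1 - e^u\<close> into
  \<open>log_phase_deriv\<close> shows that their derivatives agree; no formal logarithm is
  involved.\<close>

lemma log_phase_compose_exp:
  "log_phase oo (1 - fps_exp 1) = (fps_exp 1 - 1 - fps_X :: 'a::field_char_0 fps)"
proof -
  let ?E = "fps_exp 1 :: 'a fps"
  have "((1 - fps_X) * fps_deriv log_phase) oo (1 - ?E) = fps_X oo (1 - ?E)"
    by (simp only: log_phase_deriv)
  then have "?E * (fps_deriv log_phase oo (1 - ?E)) = 1 - ?E"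
    by (simp add: fps_compose_mult_distrib fps_compose_sub_distrib)
  then have "fps_deriv (log_phase oo (1 - ?E)) = fps_deriv (?E - 1 - fps_X)"
    by (simp add: fps_compose_deriv algebra_simps)
  then show ?thesis
    unfolding fps_deriv_eq_iff by (simp add: log_phase_def)
qed

text \<open>The substitution \<open>z = 1 - e\<^sup>u\<close> turns the phase \<open>- ln (1 - z) - z\<close> into
  \<open>e\<^sup>u - 1 - u\<close>, so the inverse series of the two square roots are related by it;
  the sign reflects \<open>z = - u + \<dots>\<close>.\<close>

lemma fps_inv_phase_sqrt_d:
  "fps_inv (phase_sqrt phase_d) oo (- fps_X)
    = (1 - (fps_exp 1 oo fps_inv (phase_sqrt phase_c)) :: 'a::field_char_0 fps)"
proof -
  let ?E = "fps_exp 1 :: 'a fps"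
  let ?wc = "phase_sqrt phase_c :: 'a fps" and ?wd = "phase_sqrt phase_d :: 'a fps"
  let ?zc = "fps_inv ?wc"
  define \<mu> where "\<mu> = (1 - ?E) oo ?zc"
  have zc0: "fps_nth ?zc 0 = 0" by (simp add: fps_inv_def)
  have mu0: "fps_nth \<mu> 0 = 0" by (simp add: \<mu>_def)
  have "fps_nth (?zc oo ?wc) (Suc 0) = 1"
    by (simp add: phase_sqrt_inv)
  then have zc1: "fps_nth ?zc (Suc 0) = 1"
    by (simp add: fps_compose_nth)
  have mu1: "fps_nth \<mu> (Suc 0) = - 1"
    using zc1 by (simp add: \<mu>_def fps_compose_nth)
  have "(?wd oo \<mu>)\<^sup>2 = (2 * log_phase) oo \<mu>"
    using mu0 by (simp add: fps_compose_power flip: phase_sqrt_d_power2)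
  also have "\<dots> = ((2 * log_phase) oo (1 - ?E)) oo ?zc"
    unfolding \<mu>_def using zc0 by (intro fps_compose_assoc) auto
  also have "\<dots> = (?wc\<^sup>2) oo ?zc"
    unfolding phase_sqrt_c_power2
    by (simp add: fps_compose_mult_distrib log_phase_compose_exp numeral_fps_const zc0)
  also have "\<dots> = fps_X\<^sup>2"
    using zc0 by (simp add: phase_sqrt_inv flip: fps_compose_power)
  \<comment> \<open>Power series over a field form an integral domain, so the square fixes the
    series up to sign; the linear coefficient then selects \<open>- fps_X\<close>.\<close>
  finally have "?wd oo \<mu> = fps_X \<or> ?wd oo \<mu> = - fps_X"
    by (simp add: power2_eq_iff)
  moreover have "fps_nth (?wd oo \<mu>) (Suc 0) = - 1"
    using mu1 by (simp add: fps_compose_nth)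
  ultimately have wd: "?wd oo \<mu> = - fps_X"
    by (auto)
  have "\<mu> = (fps_inv ?wd oo ?wd) oo \<mu>"
    using mu0 by (simp add: phase_sqrt_inv)
  also have "\<dots> = fps_inv ?wd oo (- fps_X)"
    using mu0 wd by (simp flip: fps_compose_assoc)
  finally show ?thesis
    by (simp add: \<mu>_def fps_compose_sub_distrib)
qed

lemma fps_nth_deriv_inv_phase_sqrt_eq:
  assumes "even N"
  shows "fps_nth (fps_deriv (fps_inv (phase_sqrt phase_d))) N
    = (fps_nth (fps_deriv (fps_inv (phase_sqrt phase_c))) N :: 'a::field_char_0)"
proof -
  let ?E = "fps_exp 1 :: 'a fps"
  let ?zc = "fps_inv (phase_sqrt phase_c) :: 'a fps"
  let ?zd = "fps_inv (phase_sqrt phase_d) :: 'a fps"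
  have zc0: "fps_nth ?zc 0 = 0" by (simp add: fps_inv_def)
  have "fps_deriv (?zd oo (- fps_X)) = fps_deriv (1 - (?E oo ?zc))"
    by (simp only: fps_inv_phase_sqrt_d)
  \<comment> \<open>The minus sign from \<open>- fps_X\<close> cancels the one in
    \<open>1 - exp\<close>.\<close>
  then have zd: "fps_deriv ?zd oo (- fps_X) = (?E oo ?zc) * fps_deriv ?zc"
    using zc0 by (simp add: fps_compose_deriv)
  have "(2 * (?E - 1 - fps_X)) oo ?zc = (phase_sqrt phase_c oo ?zc)\<^sup>2"
    unfolding phase_sqrt_c_power2[symmetric] using zc0 by (rule fps_compose_power[symmetric])
  also have "\<dots> = fps_X\<^sup>2"
    by (simp add: phase_sqrt_inv)
  finally have "2 * ((?E oo ?zc) - 1 - ?zc) = fps_X\<^sup>2"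
    using zc0 by (simp add: fps_compose_mult_distrib fps_compose_sub_distrib numeral_fps_const)
  then have "fps_deriv (2 * ((?E oo ?zc) - 1 - ?zc)) = fps_deriv (fps_X\<^sup>2)"
    by (simp only:)
  then have "2 * ((?E oo ?zc) * fps_deriv ?zc - fps_deriv ?zc) = 2 * fps_X"
    using zc0 by (simp add: fps_compose_deriv power2_eq_square)
  moreover have "(2 :: 'a fps) \<noteq> 0" by (simp add: numeral_fps_const)
  ultimately have "(?E oo ?zc) * fps_deriv ?zc - fps_deriv ?zc = fps_X"
    by (metis mult_left_cancel)
  then have "(?E oo ?zc) * fps_deriv ?zc = fps_X + fps_deriv ?zc"
    by (simp only: diff_eq_eq)
  then have "fps_nth (fps_deriv ?zd oo (- fps_X)) N = fps_nth (fps_X + fps_deriv ?zc) N"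
    using zd by simp
  \<comment> \<open>The summand \<open>fps_X\<close> affects only index 1, and the substitution of
    \<open>- fps_X\<close> changes only odd coefficients; an even \<open>N\<close> avoids
    both.\<close>
  moreover have "N \<noteq> 1" using assms by auto
  moreover have "fps_nth (fps_deriv ?zd oo (- fps_X)) N = fps_nth (fps_deriv ?zd) N"
    using assms by (simp add: fps_compose_uminus' del: fps_deriv_nth)
  ultimately show ?thesis by simp
qed

section \<open>Gaussian moments and the coefficient integrals\<close>

definition gauss_moment :: "nat \<Rightarrow> real" where
  "gauss_moment j = (if even j then fact j / (2 ^ (j div 2) * fact (j div 2)) else 0)"

lemma has_bochner_integral_gauss_moment:
  "has_bochner_integral lborel (\<lambda>t. std_normal_density t * t ^ j) (gauss_moment j)"
proof (cases "even j")
  case True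
  then obtain k where "j = 2 * k" by (rule evenE)
  then show ?thesis using std_normal_moment_even[of k] by (simp add: gauss_moment_def)
next
  case False
  then obtain k where "j = 2 * k + 1" by (rule oddE)
  then show ?thesis using std_normal_moment_odd[of k] by (simp add: gauss_moment_def)
qed

text \<open>The moment of order \<open>2n\<close> is \<open>(2n-1)!!\<close>, so the ratio of the
  two moments is \<open>(2n+1)(2n+3)...(2n+2k-1)\<close>. Up to the factor \<open>(-2)^k\<close>
  this is the falling product in the binomial coefficient. Sums of moments thereby become binomial
  series.\<close>

lemma gauss_moment_gbinomial:
  "(- 1) ^ k * gauss_moment (2 * (n + k)) / fact k
    = gauss_moment (2 * n) * 2 ^ k * ((- (of_nat (Suc (2 * n)) / 2)) gchoose k)"
proof (induction k)
  case 0
  then show ?case by simp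
next
  case (Suc k)
  let ?a = "- (of_nat (Suc (2 * n)) / 2) :: real"
  have "of_nat (Suc k) * (?a gchoose Suc k) = (?a - of_nat k) * (?a gchoose k)"
    using gbinomial_mult_1[of ?a k] by (simp add: algebra_simps)
  then have gb: "?a gchoose Suc k = (?a - of_nat k) * (?a gchoose k) / of_nat (Suc k)"
    by (simp add: field_simps)
  have "gauss_moment (2 * Suc l) = (2 * real l + 1) * gauss_moment (2 * l)" for l
    by (simp add: gauss_moment_def divide_simps)
  then have "gauss_moment (2 * (n + Suc k)) = (2 * real (n + k) + 1) * gauss_moment (2 * (n + k))"
    by (metis add_Suc_right)
  then have "(- 1) ^ Suc k * gauss_moment (2 * (n + Suc k)) / fact (Suc k)
      = ((- 1) ^ k * gauss_moment (2 * (n + k)) / fact k) * (- (2 * real (n + k) + 1)) / of_nat (Suc k)"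
    by (simp only:) (simp add: field_simps)
  also have "\<dots> = gauss_moment (2 * n) * 2 ^ Suc k * (?a gchoose Suc k)"
    unfolding Suc.IH gb by (simp add: divide_simps) (simp add: algebra_simps)
  finally show ?case .
qed

text \<open>Common form of both exponents, with \<open>a j\<close> the factor of
  \<open>(it)^j\<close>, so that the integral is computed once.\<close>

definition exponent :: "(nat \<Rightarrow> complex) \<Rightarrow> real \<Rightarrow> complex fps" where
  "exponent a t = fps_const (- (complex_of_real t ^ 2 / 2)) +
     Abs_fps (\<lambda>n. if n = 0 then 0 else (\<i> * complex_of_real t) ^ (n + 2) * a (n + 2))"

text \<open>Since \<open>(it)^(n+2) y^n = (it)^2 (ity)^n\<close>, the nonconstant part is
  \<open>(it)^2\<close> times \<open>tail_fps a\<close> at \<open>ity\<close>. Its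
  \<open>k\<close>-th power thus contributes \<open>(it)^(2k+m)\<close> at \<open>y^m\<close>, and
  nothing once \<open>k > m\<close>.\<close>

lemma formal_exp_exponent_nth:
  "fps_nth (formal_exp (exponent a t)) m
    = (\<Sum>k=0..m. complex_of_real (exp (- t\<^sup>2 / 2) * t ^ (2 * k + m))
        * (\<i> ^ m * (- 1) ^ k / fact k * fps_nth (tail_fps a ^ k) m))"
proof -
  let ?c = "\<i> * complex_of_real t"
  let ?G = "exponent a t - fps_const (fps_nth (exponent a t) 0)"
  have G: "?G = fps_const (?c\<^sup>2) * (tail_fps a oo (fps_const ?c * fps_X))"
  proof (rule fps_ext)
    fix n
    have "?c ^ (n + 2) = ?c\<^sup>2 * ?c ^ n" by (simp only: power_add mult.commute)
    then show "fps_nth ?G n = fps_nth (fps_const (?c\<^sup>2) * (tail_fps a oo (fps_const ?c * fps_X))) n"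
      by (simp add: exponent_def tail_fps_nth del: power_Suc power_mult_distrib add_2_eq_Suc')
  qed
  have "fps_nth (?G ^ k) m
      = complex_of_real (t ^ (2 * k + m)) * (\<i> ^ m * (- 1) ^ k * fps_nth (tail_fps a ^ k) m)" for k
  proof -
    have "(?c\<^sup>2) ^ k = (- 1) ^ k * complex_of_real t ^ (2 * k)"
      by (simp add: power_mult_distrib power_minus[of "(complex_of_real t)\<^sup>2"] power_mult)
    moreover have "fps_nth (?G ^ k) m = (?c\<^sup>2) ^ k * (?c ^ m * fps_nth (tail_fps a ^ k) m)"
      unfolding G by (simp add: power_mult_distrib fps_compose_power fps_const_power)
    ultimately show ?thesis
      by (simp add: power_mult_distrib power_add)
  qed
  moreover have "exp (fps_nth (exponent a t) 0) = complex_of_real (exp (- t\<^sup>2 / 2))"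
    by (simp add: exponent_def flip: exp_of_real)
  ultimately show ?thesis
    by (simp add: formal_exp_def fps_compose_nth sum_distrib_left mult_ac)
qed

text \<open>The factor \<open>1 / sqrt (2 pi)\<close> completes the standard normal density, and the
  finite sum is integrated term by term.\<close>

lemma integral_formal_exp_exponent:
  "complex_of_real (1 / sqrt (2 * pi)) * (LINT t|lborel. fps_nth (formal_exp (exponent a t)) m)
    = (\<Sum>k=0..m. complex_of_real (gauss_moment (2 * k + m))
        * (\<i> ^ m * (- 1) ^ k / fact k * fps_nth (tail_fps a ^ k) m))"
proof -
  have "complex_of_real (1 / sqrt (2 * pi)) * fps_nth (formal_exp (exponent a t)) m
    = (\<Sum>k=0..m. complex_of_real (std_normal_density t * t ^ (2 * k + m))
        * (\<i> ^ m * (- 1) ^ k / fact k * fps_nth (tail_fps a ^ k) m))" for t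
    by (simp add: formal_exp_exponent_nth sum_distrib_left std_normal_density_def mult_ac)
  moreover have "has_bochner_integral lborel
      (\<lambda>t. \<Sum>k=0..m. complex_of_real (std_normal_density t * t ^ (2 * k + m))
        * (\<i> ^ m * (- 1) ^ k / fact k * fps_nth (tail_fps a ^ k) m))
      (\<Sum>k=0..m. complex_of_real (gauss_moment (2 * k + m))
        * (\<i> ^ m * (- 1) ^ k / fact k * fps_nth (tail_fps a ^ k) m))"
    by (intro has_bochner_integral_sum has_bochner_integral_mult_left
        has_bochner_integral_of_real has_bochner_integral_gauss_moment)
  ultimately show ?thesis
    by (simp add: has_bochner_integral_integral_eq flip: integral_mult_right_zero)
qed

text \<open>By \<open>gauss_moment_gbinomial\<close> the sum over \<open>k\<close> is a coefficient
  of \<open>(1 + 2p)^(-n-1/2)\<close> with \<open>p = tail_fps a\<close>, to which Lagrange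
  inversion applies.\<close>

lemma integral_formal_exp_exponent_even:
  "complex_of_real (1 / sqrt (2 * pi)) * (LINT t|lborel. fps_nth (formal_exp (exponent a t)) (2 * n))
    = (- 1) ^ n * complex_of_real (gauss_moment (2 * n))
      * fps_nth (fps_deriv (fps_inv (phase_sqrt (tail_fps a)))) (2 * n)"
proof -
  let ?b = "- (of_nat (Suc (2 * n)) / 2) :: real"
  have "complex_of_real (gauss_moment (2 * k + 2 * n)) * ((- 1) ^ k / fact k)
      = complex_of_real ((- 1) ^ k * gauss_moment (2 * (n + k)) / fact k)" for k
    by (simp add: mult_ac add_ac)
  also have "\<dots> k = complex_of_real (gauss_moment (2 * n))
      * ((- (of_nat (Suc (2 * n)) / 2) gchoose k) * 2 ^ k)" for k
    \<comment> \<open>The product form of the binomial coefficient lets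
      \<open>complex_of_real\<close> pass inside it.\<close>
    unfolding gauss_moment_gbinomial by (simp add: gbinomial_prod_rev)
  finally have *: "complex_of_real (gauss_moment (2 * k + 2 * n)) * ((- 1) ^ k / fact k)
    = complex_of_real (gauss_moment (2 * n))
      * ((- (of_nat (Suc (2 * n)) / 2) gchoose k) * 2 ^ k)" for k .
  have i2n: "\<i> ^ (2 * n) = (- 1) ^ n"
    by (simp add: power_mult)
  have "(\<Sum>k=0..2*n. complex_of_real (gauss_moment (2 * k + 2 * n))
        * (\<i> ^ (2 * n) * (- 1) ^ k / fact k * fps_nth (tail_fps a ^ k) (2 * n)))
    = (\<Sum>k=0..2*n. (- 1) ^ n * (complex_of_real (gauss_moment (2 * k + 2 * n)) * ((- 1) ^ k / fact k))
        * fps_nth (tail_fps a ^ k) (2 * n))"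
    unfolding i2n by (simp add: mult_ac)
  also have "\<dots> = (- 1) ^ n * complex_of_real (gauss_moment (2 * n))
      * fps_nth (fps_binomial (- (of_nat (Suc (2 * n)) / 2)) oo (2 * tail_fps a)) (2 * n)"
    unfolding * by (simp add: fps_compose_nth sum_distrib_left power_mult_distrib
        numeral_fps_const fps_const_power mult_ac)
  also have "fps_nth (fps_binomial (- (of_nat (Suc (2 * n)) / 2)) oo (2 * tail_fps a)) (2 * n)
      = fps_nth (fps_deriv (fps_inv (phase_sqrt (tail_fps a)))) (2 * n)"
    by (rule fps_nth_binomial_compose) (simp add: tail_fps_nth)
  finally show ?thesis
    unfolding integral_formal_exp_exponent .
qed

theorem theorem1p1:
  fixes m :: nat
  shows "c_coeff m = d_coeff m"
proof -
  have c: "exponent_c t = exponent (\<lambda>n. 1 / fact n) t" for t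
    unfolding exponent_c_def exponent_def by (simp only: times_divide_eq_right mult_1_right)
  have d: "exponent_d t = exponent (\<lambda>n. 1 / of_nat n) t" for t
    unfolding exponent_d_def exponent_def by (simp only: times_divide_eq_right mult_1_right)
  show ?thesis
  proof (cases "even m")
    case True
    then obtain n where "m = 2 * n" by (rule evenE)
    then show ?thesis
      unfolding c_coeff_def d_coeff_def c d
      by (simp only: integral_formal_exp_exponent_even fps_nth_deriv_inv_phase_sqrt_eq
          even_mult_iff even_numeral simp_thms)
  next
    \<comment> \<open>Every order \<open>2k + m\<close> is odd, so both sides are sums of
      zeros.\<close>
    case False
    then show ?thesis
      unfolding c_coeff_def d_coeff_def c d integral_formal_exp_exponent
      by (simp add: gauss_moment_def)
  qed
qed

end
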